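(* Let $\mathcal{H}$ be a complex Hilbert space and let $\mathcal{A} \subseteq \mathcal{B}(\mathcal{H})$ be a norm-closed algebra of operators on $\mathcal{H}$. Let $\mathcal{Y}$ be a closed half-space of $\mathcal{H}$ and suppose that for each $T \in \mathcal{A}$ there exists a finite-dimensional subspace $\mathcal{M}_T$ of $\mathcal{H}$ such that $T\mathcal{Y} \subseteq \mathcal{Y} + \mathcal{M}_T$. Then $\mathcal{A}$ admits an invariant half-space, i.e. there is a half-space $\mathcal{L}$ of $\mathcal{H}$ with $T\mathcal{L} \subseteq \mathcal{L}$ for all $T \in \mathcal{A}$.
   Context: $\mathcal{B}(\mathcal{H})$ is the algebra of all bounded linear operators on $\mathcal{H}$. All subspaces are assumed to be norm-closed. A half-space of $\mathcal{H}$ is a subspace of infinite dimension and infinite codimension. *)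

theory Defs
  imports "HOL-Analysis.Analysis" "HOL-Library.Set_Algebras"
begin

class scaleC =
  fixes scaleC :: "complex \<Rightarrow> 'a \<Rightarrow> 'a"  (infixr "*\<^sub>C" 75)

class complex_vector = real_vector + scaleC +
  assumes scaleC_add_right: "a *\<^sub>C (x + y) = a *\<^sub>C x + a *\<^sub>C y"
    and scaleC_add_left: "(a + b) *\<^sub>C x = a *\<^sub>C x + b *\<^sub>C x"
    and scaleC_scaleC: "a *\<^sub>C (b *\<^sub>C x) = (a * b) *\<^sub>C x"
    and scaleC_one: "1 *\<^sub>C x = x"
    and scaleC_of_real: "of_real r *\<^sub>C x = r *\<^sub>R x"

global_interpretation complex_vector:
    vector_space "scaleC :: complex \<Rightarrow> 'a \<Rightarrow> 'a::complex_vector"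
  defines csubspace = complex_vector.subspace
    and cspan = complex_vector.span
  by unfold_locales
    (simp_all add: scaleC_add_right scaleC_add_left scaleC_scaleC scaleC_one)

class complex_normed_vector = complex_vector + real_normed_vector +
  assumes norm_scaleC: "norm (a *\<^sub>C x) = cmod a * norm x"

text \<open>
  The inner product is linear in the first argument. Its real part is tied to the real inner
  product of the class \<^class>\<open>real_inner\<close>; hence \<open>cinner\<close> is positive definite and
  \<open>norm x = sqrt (Re (cinner x x))\<close>.
\<close>
class complex_inner = complex_vector + real_inner +
  fixes cinner :: "'a \<Rightarrow> 'a \<Rightarrow> complex"
  assumes cinner_commute: "cinner x y = cnj (cinner y x)"
    and cinner_add_left: "cinner (x + y) z = cinner x z + cinner y z"
    and cinner_scaleC_left: "cinner (a *\<^sub>C x) y = a * cinner x y"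
    and Re_cinner: "Re (cinner x y) = inner x y"
begin

subclass complex_normed_vector
proof
  fix a :: complex and x :: 'a
  have "cinner (a *\<^sub>C x) (a *\<^sub>C x) = a * cnj (a * cinner x x)"
    by (subst cinner_scaleC_left, subst cinner_commute, subst cinner_scaleC_left) (rule refl)
  also have "\<dots> = a * cnj a * cinner x x"
    by (subst (2) cinner_commute) (simp only: complex_cnj_mult mult.assoc)
  also have "a * cnj a = complex_of_real ((cmod a)\<^sup>2)"
    by (rule complex_norm_square[symmetric])
  finally have "inner (a *\<^sub>C x) (a *\<^sub>C x) = (cmod a)\<^sup>2 * inner x x"
    by (simp flip: Re_cinner)
  then show "norm (a *\<^sub>C x) = cmod a * norm x"
    by (simp add: norm_eq_sqrt_inner real_sqrt_mult)
qed

end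

class chilbert_space = complex_inner + complete_space

instantiation blinfun :: (real_normed_vector, complex_normed_vector) complex_vector
begin

lift_definition scaleC_blinfun :: "complex \<Rightarrow> ('a \<Rightarrow>\<^sub>L 'b) \<Rightarrow> ('a \<Rightarrow>\<^sub>L 'b)"
  is "\<lambda>c T x. c *\<^sub>C T x"
proof -
  fix c :: complex and T :: "'a \<Rightarrow> 'b"
  assume "bounded_linear T"
  moreover have "bounded_linear (\<lambda>x::'b. c *\<^sub>C x)"
    by (rule bounded_linear_intro[where K = "cmod c"])
      (simp_all add: scaleC_add_right norm_scaleC scaleC_scaleC mult.commute flip: scaleC_of_real)
  ultimately show "bounded_linear (\<lambda>x. c *\<^sub>C T x)"
    by (rule bounded_linear_compose[rotated])
qed

instance
  by standard
    (transfer, simp add: scaleC_add_right scaleC_add_left scaleC_scaleC scaleC_one scaleC_of_real)+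

end

text \<open>
  \<^typ>\<open>'a \<Rightarrow>\<^sub>L 'a\<close> is the space of bounded real-linear maps with the operator norm; the
  bounded operators of a complex space are its complex-linear elements.
\<close>
definition bounded_operators :: "('a::complex_normed_vector \<Rightarrow>\<^sub>L 'a) set" where
  "bounded_operators = {T. \<forall>c x. blinfun_apply T (c *\<^sub>C x) = c *\<^sub>C blinfun_apply T x}"

definition operator_algebra :: "('a::complex_normed_vector \<Rightarrow>\<^sub>L 'a) set \<Rightarrow> bool" where
  "operator_algebra A \<longleftrightarrow>
     A \<subseteq> bounded_operators \<and> csubspace A \<and> (\<forall>S\<in>A. \<forall>T\<in>A. S o\<^sub>L T \<in> A)"

definition finite_dim_subspace :: "'a::complex_vector set \<Rightarrow> bool" where
  "finite_dim_subspace M \<longleftrightarrow> (\<exists>F. finite F \<and> M = cspan F)"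

text \<open>
  The quotient by \<open>Y\<close> is finite-dimensional iff it is spanned by the cosets of finitely many
  vectors, that is, iff \<open>Y\<close> and the span of these vectors add up to the whole space.
\<close>
definition finite_codim :: "'a::complex_vector set \<Rightarrow> bool" where
  "finite_codim Y \<longleftrightarrow> (\<exists>M. finite_dim_subspace M \<and> Y + M = UNIV)"

definition half_space :: "'a::complex_normed_vector set \<Rightarrow> bool" where
  "half_space Y \<longleftrightarrow>
     csubspace Y \<and> closed Y \<and> \<not> finite_dim_subspace Y \<and> \<not> finite_codim Y"

end

theory Submission imports Defs begin

text \<open>
  Let the rank of an operator \<open>T\<close> modulo \<open>Y\<close> be the dimension of the image of \<open>T Y\<close> in the
  quotient by \<open>Y\<close>. It is finite on \<open>A\<close> and lower semicontinuous, so by Baire's theorem it has a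
  local maximum \<open>m\<close> at some \<open>T \<in> A\<close>. Put \<open>K = {z \<in> Y. T z \<in> Y}\<close>, which has finite
  codimension in \<open>Y\<close>, and let \<open>R\<close> be spanned by vectors \<open>T y\<^sub>1, \<dots>, T y\<^sub>m\<close> that represent a basis
  of the image of \<open>T Y\<close>. Then every \<open>S \<in> A\<close> maps \<open>K\<close> into \<open>Y + R\<close>, since otherwise \<open>T + t S\<close>
  would have rank greater than \<open>m\<close> for small \<open>t\<close>. Hence the closed span of \<open>K\<close> and \<open>A K\<close> lies
  between \<open>K\<close> and \<open>Y + R\<close>; it is invariant because \<open>A\<close> is closed under composition.
\<close>

instance chilbert_space \<subseteq> banach ..

section \<open>Linear independence modulo a subspace\<close>

text \<open>For finite \<open>I\<close> and a subspace \<open>Y\<close> this is linear independence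
  of the cosets of the \<open>v i\<close>, stated without forming the quotient. Indexing by
  \<open>I\<close> makes a repeated vector count as a dependence, and lets the vectors vary while
  the index set stays fixed.\<close>

definition indep_mod :: "'a::complex_vector set \<Rightarrow> 'i set \<Rightarrow> ('i \<Rightarrow> 'a) \<Rightarrow> bool" where
  "indep_mod Y I v \<longleftrightarrow> (\<forall>c. (\<Sum>i\<in>I. c i *\<^sub>C v i) \<in> Y \<longrightarrow> (\<forall>i\<in>I. c i = 0))"

lemma csubspace_set_plus:
  assumes "csubspace Y" "csubspace M"
  shows "csubspace (Y + M)"
proof -
  have "Y + M = {x + y |x y. x \<in> Y \<and> y \<in> M}"
    by (auto simp: set_plus_def)
  with complex_vector.subspace_sums[OF assms] show ?thesis by simp
qed

lemma subset_set_plus: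
  fixes Y M :: "'a::comm_monoid_add set"
  shows "0 \<in> M \<Longrightarrow> Y \<subseteq> Y + M" "0 \<in> Y \<Longrightarrow> M \<subseteq> Y + M"
  using set_plus_intro[of _ Y 0 M] set_plus_intro[of 0 Y _ M] by auto

lemma cspan_image_sum:
  assumes "finite I" "x \<in> cspan (v ` I)"
  obtains c where "x = (\<Sum>i\<in>I. c i *\<^sub>C v i)"
proof -
  have "\<exists>c. x = (\<Sum>i\<in>I. c i *\<^sub>C v i)"
    using assms
  proof (induction I arbitrary: x rule: finite_induct)
    case empty
    then show ?case by simp
  next
    case (insert j I)
    from insert.prems obtain k where "x - k *\<^sub>C v j \<in> cspan (v ` I)"
      by (auto simp: complex_vector.span_insert)
    then obtain c where c: "x - k *\<^sub>C v j = (\<Sum>i\<in>I. c i *\<^sub>C v i)"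
      using insert.IH by blast
    have "(\<Sum>i\<in>I. (c(j := k)) i *\<^sub>C v i) = (\<Sum>i\<in>I. c i *\<^sub>C v i)"
      using insert.hyps by (intro sum.cong) auto
    with c insert.hyps have "x = (\<Sum>i\<in>insert j I. (c(j := k)) i *\<^sub>C v i)"
      by (simp add: algebra_simps)
    then show ?case by blast
  qed
  with that show ?thesis by blast
qed

text \<open>A relation modulo \<open>Y\<close> with nonzero coefficient at \<open>j\<close> can be
  solved for \<open>v j\<close>. This allows families to be built one vector at a time.\<close>

lemma indep_mod_insert:
  assumes "finite I" "j \<notin> I" "csubspace Y"
  shows "indep_mod Y (insert j I) v \<longleftrightarrow> indep_mod Y I v \<and> v j \<notin> Y + cspan (v ` I)"
proof (intro iffI conjI notI)
  assume ind: "indep_mod Y (insert j I) v"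
  show "indep_mod Y I v"
    unfolding indep_mod_def
  proof (intro allI impI ballI)
    fix c i assume c: "(\<Sum>i\<in>I. c i *\<^sub>C v i) \<in> Y" and i: "i \<in> I"
    have "(\<Sum>i\<in>I. (c(j := 0)) i *\<^sub>C v i) = (\<Sum>i\<in>I. c i *\<^sub>C v i)"
      using assms by (intro sum.cong) auto
    with c assms have "(\<Sum>i\<in>insert j I. (c(j := 0)) i *\<^sub>C v i) \<in> Y"
      by simp
    with ind i have "(c(j := 0)) i = 0"
      unfolding indep_mod_def by blast
    with i assms show "c i = 0" by (auto split: if_splits)
  qed
  assume "v j \<in> Y + cspan (v ` I)"
  then obtain y x where y: "y \<in> Y" "x \<in> cspan (v ` I)" "v j = y + x"
    by (auto elim: set_plus_elim)
  then obtain c where c: "x = (\<Sum>i\<in>I. c i *\<^sub>C v i)"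
    using cspan_image_sum assms(1) by blast
  \<comment> \<open>The equation \<open>v j = y + x\<close> is read as a relation with coefficient 1
    at \<open>j\<close> and value \<open>y\<close> in \<open>Y\<close>.\<close>
  have "(\<Sum>i\<in>I. ((\<lambda>i. - c i)(j := 1)) i *\<^sub>C v i) = (\<Sum>i\<in>I. - (c i *\<^sub>C v i))"
    using assms by (intro sum.cong) auto
  with y c assms have "(\<Sum>i\<in>insert j I. ((\<lambda>i. - c i)(j := 1)) i *\<^sub>C v i) = y"
    by (simp add: sum_negf)
  with ind y(1) have "((\<lambda>i. - c i)(j := 1)) j = 0"
    unfolding indep_mod_def by blast
  then show False by simp
next
  assume *: "indep_mod Y I v \<and> v j \<notin> Y + cspan (v ` I)"
  show "indep_mod Y (insert j I) v"
    unfolding indep_mod_def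
  proof (rule allI, rule impI)
    fix c assume "(\<Sum>i\<in>insert j I. c i *\<^sub>C v i) \<in> Y"
    then have c: "c j *\<^sub>C v j + (\<Sum>i\<in>I. c i *\<^sub>C v i) \<in> Y"
      using assms by simp
    have s: "(\<Sum>i\<in>I. c i *\<^sub>C v i) \<in> cspan (v ` I)"
      by (intro complex_vector.span_sum complex_vector.span_scale complex_vector.span_base) auto
    have "c j = 0"
    proof (rule ccontr)
      assume nz: "c j \<noteq> 0"
      have sub: "csubspace (Y + cspan (v ` I))"
        by (intro csubspace_set_plus assms complex_vector.subspace_span)
      have "c j *\<^sub>C v j = (c j *\<^sub>C v j + (\<Sum>i\<in>I. c i *\<^sub>C v i)) + - (\<Sum>i\<in>I. c i *\<^sub>C v i)"
        by simp
      also have "\<dots> \<in> Y + cspan (v ` I)"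
        using c s by (intro set_plus_intro complex_vector.span_neg)
      finally have "inverse (c j) *\<^sub>C (c j *\<^sub>C v j) \<in> Y + cspan (v ` I)"
        using sub complex_vector.subspace_scale by blast
      with nz * show False by (simp add: scaleC_scaleC)
    qed
    with c * show "\<forall>i\<in>insert j I. c i = 0"
      unfolding indep_mod_def by auto
  qed
qed

lemma indep_mod_independent:
  assumes "finite I" "csubspace Y" "indep_mod Y I v"
  shows "complex_vector.independent (v ` I) \<and> card (v ` I) = card I"
  using assms(1,3)
proof (induction I rule: finite_induct)
  case empty
  then show ?case by (simp add: complex_vector.independent_empty)
next
  case (insert j I)
  then have *: "indep_mod Y I v" "v j \<notin> Y + cspan (v ` I)"
    using indep_mod_insert[OF insert.hyps assms(2)] by auto
  have "cspan (v ` I) \<subseteq> Y + cspan (v ` I)"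
    using assms(2) complex_vector.subspace_0 by (intro subset_set_plus)
  with * have "v j \<notin> cspan (v ` I)" by blast
  with insert * show ?case
    using complex_vector.span_superset[of "v ` I"]
    by (auto simp: complex_vector.independent_insert card_insert_if)
qed

text \<open>Modulo \<open>Y\<close> each \<open>v i\<close> may be replaced by its part
  \<open>x i\<close> in \<open>cspan F\<close>. The \<open>x i\<close> are then distinct and
  independent in the span of \<open>card F\<close> vectors.\<close>

lemma indep_mod_card_le:
  assumes "finite I" "finite F" "csubspace Y" "indep_mod Y I v" "v ` I \<subseteq> Y + cspan F"
  shows "card I \<le> card F"
proof -
  have "\<forall>i\<in>I. \<exists>x\<in>cspan F. \<exists>y\<in>Y. v i = y + x"
    using assms(5) by (fastforce elim!: set_plus_elim)
  then obtain x where x: "\<And>i. i \<in> I \<Longrightarrow> x i \<in> cspan F" "\<And>i. i \<in> I \<Longrightarrow> \<exists>y\<in>Y. v i = y + x i"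
    by metis
  have "indep_mod Y I x"
    unfolding indep_mod_def
  proof (rule allI, rule impI)
    fix c assume c: "(\<Sum>i\<in>I. c i *\<^sub>C x i) \<in> Y"
    have "(\<Sum>i\<in>I. c i *\<^sub>C (v i - x i)) \<in> Y"
      using x(2) by (intro complex_vector.subspace_sum complex_vector.subspace_scale assms) force
    from complex_vector.subspace_add[OF assms(3) this c]
    have "(\<Sum>i\<in>I. c i *\<^sub>C v i) \<in> Y"
      by (simp flip: sum.distrib scaleC_add_right)
    with assms(4) show "\<forall>i\<in>I. c i = 0" unfolding indep_mod_def by blast
  qed
  from indep_mod_independent[OF assms(1,3) this]
  have "complex_vector.independent (x ` I)" "card (x ` I) = card I" by auto
  moreover have "x ` I \<subseteq> cspan F" using x(1) by blast
  ultimately show ?thesis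
    using complex_vector.independent_span_bound[OF assms(2)] by metis
qed

section \<open>Closed subspaces and stability of independence\<close>

text \<open>\<open>d\<close> is the radius of a ball around \<open>v\<close> that misses
  \<open>Y\<close>; division by \<open>k\<close> reduces the estimate to \<open>k = 1\<close>. It
  says that the coefficient of \<open>v\<close> depends continuously on the vector
  \<open>k *\<^sub>C v + y\<close>.\<close>

lemma closed_csubspace_dist:
  fixes Y :: "'a::complex_normed_vector set"
  assumes "closed Y" "csubspace Y" "v \<notin> Y"
  obtains d where "d > 0" "\<And>k y. y \<in> Y \<Longrightarrow> d * cmod k \<le> norm (k *\<^sub>C v + y)"
proof -
  have "open (- Y)" "v \<in> - Y" using assms by auto
  then obtain d where d: "d > 0" "ball v d \<subseteq> - Y"
    using openE by blast
  have "d * cmod k \<le> norm (k *\<^sub>C v + y)" if "y \<in> Y" for k y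
  proof (cases "k = 0")
    case False
    have "(- inverse k) *\<^sub>C y \<in> Y" using assms that complex_vector.subspace_scale by blast
    with d have "d \<le> dist v ((- inverse k) *\<^sub>C y)" by force
    also have "\<dots> = norm (v + inverse k *\<^sub>C y)"
      by (simp add: dist_norm)
    finally have "d * cmod k \<le> norm (v + inverse k *\<^sub>C y) * cmod k"
      by (simp add: mult_right_mono)
    also have "\<dots> = norm (k *\<^sub>C (v + inverse k *\<^sub>C y))"
      by (simp add: norm_scaleC mult.commute)
    also have "k *\<^sub>C (v + inverse k *\<^sub>C y) = k *\<^sub>C v + y"
      using False by (simp add: scaleC_add_right scaleC_scaleC scaleC_one)
    finally show ?thesis .
  qed simp
  with d that show ?thesis by blast
qed

lemma tendsto_scaleC:
  fixes v :: "'a::complex_normed_vector"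
  assumes "(k \<longlongrightarrow> l) F"
  shows "((\<lambda>n. k n *\<^sub>C v) \<longlongrightarrow> l *\<^sub>C v) F"
proof -
  have "bounded_linear (\<lambda>k. k *\<^sub>C v)"
    by (rule bounded_linear_intro[where K = "norm v"])
      (simp_all add: scaleC_add_left norm_scaleC scaleC_scaleC scaleR_conv_of_real flip: scaleC_of_real)
  from bounded_linear.tendsto[OF this assms] show ?thesis .
qed

text \<open>One vector is added at a time. If it is new, the distance estimate forces its
  coefficients along a convergent sequence to be Cauchy, so the limit has the same form.\<close>

lemma closed_set_plus_cspan:
  fixes Y :: "'a::complex_normed_vector set"
  assumes "closed Y" "csubspace Y" "finite F"
  shows "closed (Y + cspan F)"
  using assms(3)
proof (induction F rule: finite_induct)
  case empty
  then show ?case using assms by (simp add: set_plus_def)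
next
  case (insert v F)
  define Z where "Z = Y + cspan F"
  have Z: "closed Z" "csubspace Z"
    unfolding Z_def using insert assms by (auto intro: csubspace_set_plus complex_vector.subspace_span)
  have eq: "x \<in> Y + cspan (insert v F) \<longleftrightarrow> (\<exists>k. x - k *\<^sub>C v \<in> Z)" for x
  proof
    assume "x \<in> Y + cspan (insert v F)"
    then obtain y u k where "y \<in> Y" "x = y + u" "u - k *\<^sub>C v \<in> cspan F"
      by (auto simp: complex_vector.span_insert elim!: set_plus_elim)
    then have "y + (u - k *\<^sub>C v) \<in> Z" unfolding Z_def by blast
    with \<open>x = y + u\<close> show "\<exists>k. x - k *\<^sub>C v \<in> Z" by (metis add_diff_eq)
  next
    assume "\<exists>k. x - k *\<^sub>C v \<in> Z"
    then obtain k y u where *: "y \<in> Y" "u \<in> cspan F" "x - k *\<^sub>C v = y + u"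
      unfolding Z_def by (auto elim: set_plus_elim)
    then have "x = y + (u + k *\<^sub>C v)" by (simp add: algebra_simps)
    moreover have "u + k *\<^sub>C v \<in> cspan (insert v F)"
      using * by (auto simp: complex_vector.span_insert intro!: exI[of _ k])
    ultimately show "x \<in> Y + cspan (insert v F)" using * by blast
  qed
  show ?case
  proof (cases "v \<in> Z")
    case True
    have "Y + cspan (insert v F) = Z"
    proof (intro set_eqI)
      fix x
      show "x \<in> Y + cspan (insert v F) \<longleftrightarrow> x \<in> Z"
        unfolding eq
        using Z(2) True complex_vector.subspace_add complex_vector.subspace_scale
          complex_vector.subspace_diff by (metis diff_add_cancel)
    qed
    with Z show ?thesis by simp
  next
    case False
    then obtain d where d: "d > 0" "\<And>k y. y \<in> Z \<Longrightarrow> d * cmod k \<le> norm (k *\<^sub>C v + y)"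
      using closed_csubspace_dist Z by metis
    show ?thesis
      unfolding closed_sequential_limits
    proof (intro allI impI, elim conjE)
      fix x l assume x: "\<forall>n. x n \<in> Y + cspan (insert v F)" and l: "x \<longlonglongrightarrow> l"
      from x obtain k where k: "\<And>n. x n - k n *\<^sub>C v \<in> Z" unfolding eq by metis
      have le: "d * cmod (k m - k n) \<le> norm (x m - x n)" for m n
      proof -
        have "(x m - k m *\<^sub>C v) - (x n - k n *\<^sub>C v) \<in> Z"
          using k Z complex_vector.subspace_diff by blast
        from d(2)[OF this, of "k m - k n"] show ?thesis
          by (simp add: complex_vector.scale_left_diff_distrib algebra_simps)
      qed
      have "Cauchy k"
        unfolding Cauchy_def
      proof (intro allI impI)
        fix e :: real assume "e > 0"
        with d(1) have "d * e > 0" by simp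
        with LIMSEQ_imp_Cauchy[OF l] obtain N where N: "\<forall>m\<ge>N. \<forall>n\<ge>N. dist (x m) (x n) < d * e"
          unfolding Cauchy_def by blast
        have "dist (k m) (k n) < e" if "m \<ge> N" "n \<ge> N" for m n
        proof -
          have "d * dist (k m) (k n) < d * e"
            using le[of m n] N that by (fastforce simp: dist_norm)
          with d(1) show ?thesis by simp
        qed
        then show "\<exists>M. \<forall>m\<ge>M. \<forall>n\<ge>M. dist (k m) (k n) < e" by blast
      qed
      then obtain k' where "k \<longlonglongrightarrow> k'"
        using Cauchy_convergent convergent_def by blast
      then have "(\<lambda>n. x n - k n *\<^sub>C v) \<longlonglongrightarrow> l - k' *\<^sub>C v"
        by (intro tendsto_diff l tendsto_scaleC)
      then have "l - k' *\<^sub>C v \<in> Z"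
        using closed_sequentially[OF Z(1), of "\<lambda>n. x n - k n *\<^sub>C v"] k by blast
      then show "l \<in> Y + cspan (insert v F)" unfolding eq by blast
    qed
  qed
qed

text \<open>The quotient norm dominates the sum of the moduli of the coefficients. The coefficient
  of a new vector is bounded by its distance from the span of the others and \<open>Y\<close>; the
  remaining ones follow by induction after subtracting its term.\<close>

lemma indep_mod_bounded_below:
  fixes Y :: "'a::complex_normed_vector set"
  assumes "closed Y" "csubspace Y" "finite I" "indep_mod Y I v"
  shows "\<exists>\<delta>>0. \<forall>c. \<forall>y\<in>Y. \<delta> * (\<Sum>i\<in>I. cmod (c i)) \<le> norm ((\<Sum>i\<in>I. c i *\<^sub>C v i) + y)"
  using assms(3,4)
proof (induction I rule: finite_induct)
  case empty
  show ?case by (auto intro: exI[of _ 1])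
next
  case (insert j I)
  define Z where "Z = Y + cspan (v ` I)"
  have Z: "closed Z" "csubspace Z"
    unfolding Z_def using insert assms
    by (auto intro: csubspace_set_plus complex_vector.subspace_span closed_set_plus_cspan)
  have ind: "indep_mod Y I v" "v j \<notin> Z"
    using insert.prems indep_mod_insert[OF insert.hyps assms(2)] unfolding Z_def by auto
  obtain d where d: "d > 0" "\<And>k y. y \<in> Z \<Longrightarrow> d * cmod k \<le> norm (k *\<^sub>C v j + y)"
    using closed_csubspace_dist Z ind by metis
  obtain \<delta> where \<delta>: "\<delta> > 0"
    "\<And>c y. y \<in> Y \<Longrightarrow> \<delta> * (\<Sum>i\<in>I. cmod (c i)) \<le> norm ((\<Sum>i\<in>I. c i *\<^sub>C v i) + y)"
    using insert.IH ind by blast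
  \<comment> \<open>The summand \<open>1 / d\<close> bounds the coefficient at \<open>j\<close>. The
    other bounds the rest: it divides by \<delta> the estimate
    \<open>norm (s + y) \<le> N * (1 + norm (v j) / d)\<close>, with \<open>N\<close> the norm of
    the full combination.\<close>
  define C where "C = 1 / d + (1 + norm (v j) / d) / \<delta>"
  have "C > 0" unfolding C_def using d \<delta> by (simp add: add_pos_nonneg)
  have "(\<Sum>i\<in>insert j I. cmod (c i)) \<le> C * norm ((\<Sum>i\<in>insert j I. c i *\<^sub>C v i) + y)"
    if y: "y \<in> Y" for c y
  proof -
    define s where "s = (\<Sum>i\<in>I. c i *\<^sub>C v i)"
    define N where "N = norm (c j *\<^sub>C v j + (s + y))"
    have "s \<in> cspan (v ` I)" unfolding s_def
      by (intro complex_vector.span_sum complex_vector.span_scale complex_vector.span_base) auto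
    from set_plus_intro[OF y this] have "s + y \<in> Z"
      unfolding Z_def by (simp add: add.commute[of s y])
    from d(2)[OF this] have cj: "cmod (c j) \<le> N / d"
      unfolding N_def using d(1) by (simp add: field_simps)
    have "\<delta> * (\<Sum>i\<in>I. cmod (c i)) \<le> norm (s + y)"
      using \<delta>(2) y unfolding s_def by blast
    also have "\<dots> \<le> N + cmod (c j) * norm (v j)"
      unfolding N_def using norm_triangle_ineq4[of "c j *\<^sub>C v j + (s + y)" "c j *\<^sub>C v j"]
      by (simp add: norm_scaleC)
    also have "\<dots> \<le> N + N / d * norm (v j)"
      using mult_right_mono[OF cj norm_ge_zero[of "v j"]] by simp
    finally have "(\<Sum>i\<in>I. cmod (c i)) \<le> (N + N / d * norm (v j)) / \<delta>"
      using \<delta>(1) by (simp add: field_simps)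
    with cj have "cmod (c j) + (\<Sum>i\<in>I. cmod (c i)) \<le> N / d + (N + N / d * norm (v j)) / \<delta>"
      by linarith
    also have "\<dots> = C * N" unfolding C_def by (simp add: algebra_simps add_divide_distrib)
    finally show ?thesis
      using insert.hyps unfolding N_def s_def by (simp add: add.assoc)
  qed
  with \<open>C > 0\<close> show ?case
    by (intro exI[of _ "1 / C"]) (simp add: field_simps)
qed

text \<open>A nontrivial relation among the \<open>w i\<close> would bring the same combination of
  the \<open>v i\<close> closer to \<open>Y\<close> than the lower bound permits.\<close>

lemma indep_mod_perturb:
  fixes Y :: "'a::complex_normed_vector set"
  assumes "closed Y" "csubspace Y" "finite I" "indep_mod Y I v"
  obtains \<delta> where "\<delta> > 0" "\<And>w. (\<And>i. i \<in> I \<Longrightarrow> norm (w i - v i) < \<delta>) \<Longrightarrow> indep_mod Y I w"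
proof -
  obtain \<delta> where \<delta>: "\<delta> > 0"
    "\<And>c y. y \<in> Y \<Longrightarrow> \<delta> * (\<Sum>i\<in>I. cmod (c i)) \<le> norm ((\<Sum>i\<in>I. c i *\<^sub>C v i) + y)"
    using indep_mod_bounded_below[OF assms] by blast
  have "indep_mod Y I w" if w: "\<And>i. i \<in> I \<Longrightarrow> norm (w i - v i) < \<delta>" for w
    unfolding indep_mod_def
  proof (intro allI impI ballI, rule ccontr)
    fix c i assume c: "(\<Sum>i\<in>I. c i *\<^sub>C w i) \<in> Y" and i: "i \<in> I" "c i \<noteq> 0"
    have "\<delta> * (\<Sum>i\<in>I. cmod (c i)) \<le> norm ((\<Sum>i\<in>I. c i *\<^sub>C v i) + - (\<Sum>i\<in>I. c i *\<^sub>C w i))"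
      using \<delta>(2) c complex_vector.subspace_neg[OF assms(2)] by blast
    also have "\<dots> = norm (\<Sum>i\<in>I. c i *\<^sub>C (v i - w i))"
      by (simp add: complex_vector.scale_right_diff_distrib sum_subtractf)
    also have "\<dots> \<le> (\<Sum>i\<in>I. cmod (c i) * norm (w i - v i))"
      by (rule sum_norm_le) (simp add: norm_scaleC norm_minus_commute)
    also have "\<dots> < (\<Sum>i\<in>I. cmod (c i) * \<delta>)"
    proof (rule sum_strict_mono_ex1[OF assms(3)])
      show "\<forall>i\<in>I. cmod (c i) * norm (w i - v i) \<le> cmod (c i) * \<delta>"
        using less_imp_le[OF w] by (simp add: mult_left_mono)
      show "\<exists>i\<in>I. cmod (c i) * norm (w i - v i) < cmod (c i) * \<delta>"
        using w[OF i(1)] i by (intro bexI[of _ i] mult_strict_left_mono) auto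
    qed
    finally show False by (simp add: sum_distrib_left mult.commute)
  qed
  with \<delta>(1) that show ?thesis by blast
qed

lemma blinfun_finite_small:
  fixes y :: "'i \<Rightarrow> 'a::real_normed_vector"
  assumes "finite I" "\<delta> > 0"
  obtains \<epsilon> where "\<epsilon> > 0"
    "\<And>(S :: 'a \<Rightarrow>\<^sub>L 'b::real_normed_vector) i. norm S < \<epsilon> \<Longrightarrow> i \<in> I \<Longrightarrow>
      norm (blinfun_apply S (y i)) < \<delta>"
proof -
  \<comment> \<open>A common bound for the norms of the \<open>y i\<close>; the summand 1 keeps it
    positive even if all of them vanish.\<close>
  define C where "C = 1 + (\<Sum>i\<in>I. norm (y i))"
  have C: "norm (y i) \<le> C" if "i \<in> I" for i
    unfolding C_def using assms(1) that
    by (auto intro!: add_increasing member_le_sum[where f = "\<lambda>i. norm (y i)"])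
  have C0: "C > 0"
    unfolding C_def by (auto intro!: add_pos_nonneg sum_nonneg)
  show ?thesis
  proof (rule that)
    show "\<delta> / C > 0" using C0 assms(2) by simp
    fix S :: "'a \<Rightarrow>\<^sub>L 'b" and i assume S: "norm S < \<delta> / C" and i: "i \<in> I"
    have "norm (blinfun_apply S (y i)) \<le> norm S * norm (y i)" by (rule norm_blinfun)
    also have "\<dots> \<le> norm S * C" using C[OF i] by (simp add: mult_left_mono)
    also have "\<dots> < \<delta>" using S C0 by (simp add: field_simps)
    finally show "norm (blinfun_apply S (y i)) < \<delta>" .
  qed
qed

section \<open>Rank modulo Y and its local maxima\<close>

text \<open>Only lower bounds on the rank are expressed, by witnesses in \<open>Y\<close>, so
  infinite rank needs no separate treatment.\<close>

definition rank_mod_ge :: "'a::complex_vector set \<Rightarrow> nat \<Rightarrow> ('a \<Rightarrow> 'a) \<Rightarrow> bool" where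
  "rank_mod_ge Y m T \<longleftrightarrow> (\<exists>y. y ` {..<m} \<subseteq> Y \<and> indep_mod Y {..<m} (\<lambda>i. T (y i)))"

text \<open>Used mostly in contrapositive form: where the rank cannot exceed \<open>m\<close>, any
  \<open>m\<close> witnesses span the image of \<open>T\<close> modulo \<open>Y\<close>.\<close>

lemma rank_mod_ge_Suc:
  assumes "csubspace Y" "y ` {..<m} \<subseteq> Y" "indep_mod Y {..<m} (\<lambda>i. T (y i))"
    and "z \<in> Y" "T z \<notin> Y + cspan ((\<lambda>i. T (y i)) ` {..<m})"
  shows "rank_mod_ge Y (Suc m) T"
proof -
  define y' where "y' = y(m := z)"
  have eq: "(\<lambda>i. T (y' i)) ` {..<m} = (\<lambda>i. T (y i)) ` {..<m}"
    "indep_mod Y {..<m} (\<lambda>i. T (y' i)) \<longleftrightarrow> indep_mod Y {..<m} (\<lambda>i. T (y i))"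
    unfolding y'_def indep_mod_def by (auto intro!: image_cong)
  have "indep_mod Y {..<Suc m} (\<lambda>i. T (y' i))"
    unfolding lessThan_Suc using assms
    by (subst indep_mod_insert) (simp_all add: eq, simp add: y'_def)
  moreover have "y' ` {..<Suc m} \<subseteq> Y"
    using assms by (auto simp: y'_def less_Suc_eq)
  ultimately show ?thesis unfolding rank_mod_ge_def by blast
qed

text \<open>This is lower semicontinuity: the same witnesses \<open>y i\<close> serve all operators
  near \<open>T\<close>, because their finitely many images move only a little.\<close>

lemma rank_mod_ge_open:
  fixes T :: "'a::complex_normed_vector \<Rightarrow>\<^sub>L 'a"
  assumes "closed Y" "csubspace Y" "rank_mod_ge Y m (blinfun_apply T)"
  obtains \<epsilon> where "\<epsilon> > 0"
    "\<And>S. norm (S - T) < \<epsilon> \<Longrightarrow> rank_mod_ge Y m (blinfun_apply S)"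
proof -
  obtain y where y: "y ` {..<m} \<subseteq> Y" "indep_mod Y {..<m} (\<lambda>i. T (y i))"
    using assms(3) unfolding rank_mod_ge_def by blast
  obtain \<delta> where \<delta>: "\<delta> > 0"
    "\<And>w. (\<And>i. i \<in> {..<m} \<Longrightarrow> norm (w i - T (y i)) < \<delta>) \<Longrightarrow> indep_mod Y {..<m} w"
    using indep_mod_perturb[OF assms(1,2) _ y(2)] by blast
  obtain \<epsilon> where \<epsilon>: "\<epsilon> > 0"
    "\<And>(S :: 'a \<Rightarrow>\<^sub>L 'a) i. norm S < \<epsilon> \<Longrightarrow> i \<in> {..<m} \<Longrightarrow> norm (blinfun_apply S (y i)) < \<delta>"
    using blinfun_finite_small[OF finite_lessThan[of m] \<delta>(1), of y] by blast
  have "rank_mod_ge Y m (blinfun_apply S)" if "norm (S - T) < \<epsilon>" for S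
    unfolding rank_mod_ge_def
    using y(1) \<delta>(2)[of "\<lambda>i. S (y i)"] \<epsilon>(2)[OF that] by (auto simp: blinfun.diff_left)
  with \<epsilon>(1) that show ?thesis by blast
qed

text \<open>Without a local maximum, the sets \<open>G m\<close> of rank at least \<open>m\<close>
  would be open and dense in \<open>A\<close> for every \<open>m\<close>. \<open>A\<close> is
  completely metrizable, so some operator would lie in all of them and have infinite rank modulo
  \<open>Y\<close>.\<close>

lemma locally_maximal_rank:
  fixes A :: "('a::{complex_normed_vector, banach} \<Rightarrow>\<^sub>L 'a) set"
  assumes "closed A" "A \<noteq> {}" "closed Y" "csubspace Y"
    and fin: "\<And>T. T \<in> A \<Longrightarrow> \<exists>M. finite_dim_subspace M \<and> blinfun_apply T ` Y \<subseteq> Y + M"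
  obtains T m \<epsilon> where "T \<in> A" "rank_mod_ge Y m (blinfun_apply T)" "\<epsilon> > 0"
    "\<And>S. S \<in> A \<Longrightarrow> norm (S - T) < \<epsilon> \<Longrightarrow> \<not> rank_mod_ge Y (Suc m) (blinfun_apply S)"
proof (rule ccontr)
  assume "\<not> thesis"
  with that have *: "\<exists>S\<in>A. norm (S - T) < \<epsilon> \<and> rank_mod_ge Y (Suc m) (blinfun_apply S)"
    if "T \<in> A" "rank_mod_ge Y m (blinfun_apply T)" "\<epsilon> > 0" for T m \<epsilon>
    using that by metis
  define G where "G m = {T \<in> A. rank_mod_ge Y m (blinfun_apply T)}" for m
  have dense: "A \<subseteq> closure (G m)" for m
  proof (induction m)
    case 0
    \<comment> \<open>The empty family witnesses rank at least 0; density then passes from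
      \<open>G m\<close> to \<open>G (Suc m)\<close>, since the rank can be raised by arbitrarily
      small changes.\<close>
    have "G 0 = A" by (auto simp: G_def rank_mod_ge_def indep_mod_def)
    then show ?case using closure_subset by simp
  next
    case (Suc m)
    have "G m \<subseteq> closure (G (Suc m))"
    proof
      fix T assume "T \<in> G m"
      then have "\<exists>S\<in>G (Suc m). norm (S - T) < e" if "e > 0" for e
        using *[of T m e] that unfolding G_def by blast
      then show "T \<in> closure (G (Suc m))"
        by (simp add: closure_approachable dist_norm)
    qed
    then have "closure (G m) \<subseteq> closure (G (Suc m))"
      by (simp add: closure_minimal)
    with Suc show ?case by blast
  qed
  have "openin (top_of_set A) (G m)" for m
    unfolding openin_euclidean_subtopology_iff
  proof (intro conjI ballI)
    show "G m \<subseteq> A" by (auto simp: G_def)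
    fix T assume "T \<in> G m"
    then obtain \<epsilon> where "\<epsilon> > 0" "\<And>S. norm (S - T) < \<epsilon> \<Longrightarrow> rank_mod_ge Y m (blinfun_apply S)"
      using rank_mod_ge_open[OF assms(3,4)] unfolding G_def by blast
    then show "\<exists>e>0. \<forall>S\<in>A. dist S T < e \<longrightarrow> S \<in> G m"
      by (auto simp: G_def dist_norm)
  qed
  moreover have "top_of_set A closure_of (G m) = topspace (top_of_set A)" for m
    using dense[of m] by (auto simp: closure_of_subtopology G_def Int_absorb1)
  moreover have "completely_metrizable_space (top_of_set A)"
    using assms(1) completely_metrizable_space_closedin completely_metrizable_space_euclidean
    by fastforce
  ultimately have "top_of_set A closure_of \<Inter>(range G) = topspace (top_of_set A)"
    by (intro Baire_category) auto
  with assms(2) have "\<Inter>(range G) \<noteq> {}" by auto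
  then obtain T where T: "\<And>m. T \<in> G m" by auto
  then obtain F where F: "finite F" "blinfun_apply T ` Y \<subseteq> Y + cspan F"
    using fin[of T] unfolding G_def finite_dim_subspace_def by auto
  \<comment> \<open>One witness more than there are vectors spanning the defect of \<open>T\<close>
    is impossible.\<close>
  obtain y where "y ` {..<Suc (card F)} \<subseteq> Y" "indep_mod Y {..<Suc (card F)} (\<lambda>i. T (y i))"
    using T[of "Suc (card F)"] unfolding G_def rank_mod_ge_def by blast
  with F indep_mod_card_le[OF finite_lessThan F(1) assms(4), of "Suc (card F)"]
  have "card {..<Suc (card F)} \<le> card F" by blast
  then show False by simp
qed

section \<open>Closures, finite dimension and codimension\<close>

lemma csubspace_closure:
  fixes V :: "'a::complex_normed_vector set"
  assumes "csubspace V"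
  shows "csubspace (closure V)"
  unfolding complex_vector.subspace_def
proof (intro conjI ballI allI)
  show "0 \<in> closure V"
    using assms closure_subset complex_vector.subspace_0 by blast
  fix x assume x: "x \<in> closure V"
  then obtain f where f: "\<And>n. f n \<in> V" "f \<longlonglongrightarrow> x"
    unfolding closure_sequential by blast
  {
    fix y assume "y \<in> closure V"
    then obtain g where g: "\<And>n. g n \<in> V" "g \<longlonglongrightarrow> y"
      unfolding closure_sequential by blast
    show "x + y \<in> closure V"
      unfolding closure_sequential
      using f g complex_vector.subspace_add[OF assms]
      by (intro exI[of _ "\<lambda>n. f n + g n"]) (auto intro: tendsto_add)
  }
  fix c
  have "bounded_linear (\<lambda>x::'a. c *\<^sub>C x)"
    by (rule bounded_linear_intro[where K = "cmod c"])
      (simp_all add: scaleC_add_right norm_scaleC scaleC_scaleC mult.commute flip: scaleC_of_real)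
  from bounded_linear.tendsto[OF this f(2)] show "c *\<^sub>C x \<in> closure V"
    unfolding closure_sequential
    using f complex_vector.subspace_scale[OF assms] by (intro exI[of _ "\<lambda>n. c *\<^sub>C f n"]) auto
qed

text \<open>A maximal independent subset of \<open>V\<close> spans \<open>V\<close> exactly, and is
  finite because it lies in the span of \<open>F\<close>.\<close>

lemma finite_dim_subspace_subset:
  assumes "csubspace V" "finite F" "V \<subseteq> cspan F"
  shows "finite_dim_subspace V"
proof -
  obtain B where B: "B \<subseteq> V" "complex_vector.independent B" "V \<subseteq> cspan B"
    using complex_vector.maximal_independent_subset by blast
  then have "finite B"
    using complex_vector.independent_span_bound[OF assms(2)] assms(3) by blast
  moreover have "V = cspan B"
    using B assms(1) complex_vector.span_minimal by blast
  ultimately show ?thesis unfolding finite_dim_subspace_def by blast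
qed

lemma finite_codim_set_plus:
  assumes "finite_codim (Y + M)" "finite_dim_subspace M"
  shows "finite_codim Y"
proof -
  obtain F G where FG: "finite F" "M = cspan F" "finite G" "Y + M + cspan G = UNIV"
    using assms unfolding finite_codim_def finite_dim_subspace_def by blast
  have "cspan (F \<union> G) = cspan F + cspan G"
    by (auto simp: complex_vector.span_Un set_plus_def)
  then have "Y + cspan (F \<union> G) = UNIV"
    using FG(2,4) by (simp add: add.assoc)
  moreover have "finite_dim_subspace (cspan (F \<union> G))"
    unfolding finite_dim_subspace_def using FG(1,3) by (intro exI[of _ "F \<union> G"]) simp
  ultimately show ?thesis unfolding finite_codim_def by blast
qed

lemma finite_codim_mono:
  assumes "finite_codim L" "L \<subseteq> Y"
  shows "finite_codim Y"
proof -
  obtain M where M: "finite_dim_subspace M" "L + M = UNIV"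
    using assms(1) unfolding finite_codim_def by blast
  have "L + M \<subseteq> Y + M"
    using assms(2) by (rule set_plus_mono2) (rule subset_refl)
  with M(2) have "Y + M = UNIV" by (simp add: top.extremum_unique)
  with M(1) show ?thesis unfolding finite_codim_def by blast
qed

text \<open>The preimage of \<open>V\<close> under \<open>f\<close> is a complex subspace containing
  \<open>G\<close>. Homogeneity is a separate assumption because a \<open>blinfun\<close> is only
  real-linear by its type.\<close>

lemma clinear_span_subset:
  assumes "\<And>x y. f (x + y) = f x + f y" "\<And>c x. f (c *\<^sub>C x) = c *\<^sub>C f x"
    and "f ` G \<subseteq> V" "csubspace V"
  shows "f ` cspan G \<subseteq> V"
proof -
  have "f 0 = 0" using assms(1)[of 0 0] by simp
  then have "csubspace {x. f x \<in> V}"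
    using assms by (auto simp: complex_vector.subspace_def)
  with assms(3) have "cspan G \<subseteq> {x. f x \<in> V}"
    by (intro complex_vector.span_minimal) auto
  then show ?thesis by blast
qed

section \<open>A common finite-dimensional defect\<close>

text \<open>One space \<open>M\<close> replaces those depending on the operator, at the price of
  shrinking \<open>Y\<close> to \<open>K\<close>. The finite set \<open>B\<close> records that
  \<open>K\<close> is still large in \<open>Y\<close>.\<close>

lemma uniform_defect_on_finite_codim:
  fixes A :: "('a::{complex_normed_vector, banach} \<Rightarrow>\<^sub>L 'a) set"
  assumes A: "operator_algebra A" "closed A" and Y: "closed Y" "csubspace Y"
    and fin: "\<And>T. T \<in> A \<Longrightarrow> \<exists>M. finite_dim_subspace M \<and> blinfun_apply T ` Y \<subseteq> Y + M"
  obtains K M B where "K \<subseteq> Y" "finite B" "Y \<subseteq> cspan (K \<union> B)" "finite_dim_subspace M"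
    "\<forall>T\<in>A. blinfun_apply T ` K \<subseteq> Y + M"
proof -
  have sub: "csubspace A" and lin: "\<And>T c x. T \<in> A \<Longrightarrow> blinfun_apply T (c *\<^sub>C x) = c *\<^sub>C blinfun_apply T x"
    using A unfolding operator_algebra_def bounded_operators_def by blast+
  have "A \<noteq> {}" using sub complex_vector.subspace_0 by blast
  with locally_maximal_rank[OF A(2) _ Y fin]
  obtain T m \<epsilon> where T: "T \<in> A" "rank_mod_ge Y m (blinfun_apply T)" "\<epsilon> > 0"
    and max: "\<And>S. S \<in> A \<Longrightarrow> norm (S - T) < \<epsilon> \<Longrightarrow> \<not> rank_mod_ge Y (Suc m) (blinfun_apply S)"
    by blast
  then obtain y where y: "y ` {..<m} \<subseteq> Y" "indep_mod Y {..<m} (\<lambda>i. T (y i))"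
    unfolding rank_mod_ge_def by blast
  define R where "R = cspan ((\<lambda>i. T (y i)) ` {..<m})"
  define K where "K = {z \<in> Y. T z \<in> Y}"
  have "z \<in> cspan (K \<union> y ` {..<m})" if "z \<in> Y" for z
  proof -
    \<comment> \<open>\<open>T\<close> lies in its own \<epsilon>-neighbourhood, so its rank is
      exactly \<open>m\<close> and the chosen images span modulo \<open>Y\<close>.\<close>
    have "T z \<in> Y + R"
      using rank_mod_ge_Suc[OF Y(2) y that] max[OF T(1)] T(3) unfolding R_def by auto
    then obtain u r where u: "u \<in> Y" "r \<in> R" "T z = u + r"
      by (auto elim: set_plus_elim)
    then obtain c where c: "r = (\<Sum>i<m. c i *\<^sub>C T (y i))"
      unfolding R_def using cspan_image_sum by blast
    \<comment> \<open>\<open>x\<close> has image \<open>r\<close>, so subtracting it from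
      \<open>z\<close> removes the part of \<open>T z\<close> outside \<open>Y\<close>; hence
      \<open>z - x\<close> is in \<open>K\<close>.\<close>
    define x where "x = (\<Sum>i<m. c i *\<^sub>C y i)"
    have "T x = r"
      unfolding x_def c by (simp add: blinfun.sum_right lin[OF T(1)])
    then have "T (z - x) \<in> Y" using u by (simp add: blinfun.diff_right)
    moreover have "x \<in> Y"
      unfolding x_def using y(1)
      by (intro complex_vector.subspace_sum complex_vector.subspace_scale Y) auto
    ultimately have "z - x \<in> K"
      unfolding K_def using that Y complex_vector.subspace_diff by blast
    moreover have "x \<in> cspan (K \<union> y ` {..<m})"
      unfolding x_def
      by (intro complex_vector.span_sum complex_vector.span_scale complex_vector.span_base) auto
    ultimately show ?thesis
      using complex_vector.span_add[of "z - x" "K \<union> y ` {..<m}" x]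
      by (simp add: complex_vector.span_base)
  qed
  moreover have "S z \<in> Y + R" if "S \<in> A" "z \<in> K" for S z
  proof (rule ccontr)
    assume no: "S z \<notin> Y + R"
    \<comment> \<open>\<open>S z\<close> is appended at index \<open>m\<close> to the images under
      \<open>T\<close>, giving \<open>Suc m\<close> vectors independent modulo
      \<open>Y\<close>.\<close>
    define v where "v i = (if i < m then T (y i) else S z)" for i
    have img: "v ` {..<m} = (\<lambda>i. T (y i)) ` {..<m}"
      by (auto simp: v_def)
    have "indep_mod Y {..<m} v"
      using y(2) unfolding indep_mod_def v_def by simp
    then have "indep_mod Y {..<Suc m} v"
      unfolding lessThan_Suc using no Y
      by (subst indep_mod_insert) (simp_all add: img R_def, simp add: v_def)
    then obtain \<delta> where \<delta>: "\<delta> > 0"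
      "\<And>w. (\<And>i. i \<in> {..<Suc m} \<Longrightarrow> norm (w i - v i) < \<delta>) \<Longrightarrow> indep_mod Y {..<Suc m} w"
      using indep_mod_perturb[OF Y finite_lessThan] by blast
    obtain \<epsilon>' where \<epsilon>': "\<epsilon>' > 0"
      "\<And>(S :: 'a \<Rightarrow>\<^sub>L 'a) i. norm S < \<epsilon>' \<Longrightarrow> i \<in> {..<m} \<Longrightarrow> norm (blinfun_apply S (y i)) < \<delta>"
      using blinfun_finite_small[OF finite_lessThan[of m] \<delta>(1), of y] by blast
    \<comment> \<open>The scaled operator must stay within the maximality radius \<epsilon> and the
      perturbation radius \<open>\<epsilon>'\<close>; adding 1 avoids division by zero and makes the
      bound strict.\<close>
    define t where "t = min \<epsilon> \<epsilon>' / (norm S + 1)"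
    have t: "t > 0" unfolding t_def using T(3) \<epsilon>'(1) by (simp add: add_nonneg_pos)
    have "norm (t *\<^sub>R S) < min \<epsilon> \<epsilon>'"
    proof -
      have "norm (t *\<^sub>R S) = t * norm S" using t by simp
      also have "\<dots> < t * (norm S + 1)" using t by simp
      also have "\<dots> = min \<epsilon> \<epsilon>'"
        unfolding t_def using norm_ge_zero[of S] by (simp add: add_nonneg_eq_0_iff)
      finally show ?thesis .
    qed
    then have small: "norm (t *\<^sub>R S) < \<epsilon>" "norm (t *\<^sub>R S) < \<epsilon>'" by auto
    define T' where "T' = T + t *\<^sub>R S"
    have T': "T' \<in> A"
      unfolding T'_def scaleC_of_real[symmetric]
      using sub T(1) that(1) complex_vector.subspace_add complex_vector.subspace_scale by blast
    have "rank_mod_ge Y (Suc m) (blinfun_apply T')"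
    proof (rule rank_mod_ge_Suc[OF Y(2) y(1)])
      \<comment> \<open>Only the first \<open>m\<close> entries move, from \<open>T\<close> to
        \<open>T'\<close>; the last stays \<open>S z\<close>. Its independence from the others thus
        survives, however small \<open>t\<close> is.\<close>
      define w where "w i = (if i < m then T' (y i) else S z)" for i
      have "indep_mod Y {..<Suc m} w"
        using \<epsilon>'(2)[OF small(2)] \<delta>(1)
        by (intro \<delta>(2)) (auto simp: w_def v_def T'_def blinfun.add_left)
      moreover have "w ` {..<m} = (\<lambda>i. T' (y i)) ` {..<m}"
        by (auto simp: w_def)
      ultimately have w: "indep_mod Y {..<m} w" "S z \<notin> Y + cspan ((\<lambda>i. T' (y i)) ` {..<m})"
        unfolding lessThan_Suc using indep_mod_insert[of "{..<m}" m Y w] Y(2)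
        by (auto simp: w_def[of m])
      then show "indep_mod Y {..<m} (\<lambda>i. T' (y i))"
        unfolding indep_mod_def w_def by simp
      show "z \<in> Y" using that unfolding K_def by simp
      \<comment> \<open>Since \<open>T z\<close> lies in \<open>Y\<close>, modulo \<open>Y\<close>
        the vector \<open>T' z\<close> is the nonzero multiple \<open>t\<close> of
        \<open>S z\<close>.\<close>
      show "T' z \<notin> Y + cspan ((\<lambda>i. T' (y i)) ` {..<m})" (is "_ \<notin> ?Z")
      proof
        have Z: "csubspace ?Z"
          by (intro csubspace_set_plus Y complex_vector.subspace_span)
        assume "T' z \<in> ?Z"
        moreover have "T z \<in> ?Z"
          using that subset_set_plus(1)[of _ Y] complex_vector.span_zero unfolding K_def by blast
        ultimately have "T' z - T z \<in> ?Z" using Z complex_vector.subspace_diff by blast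
        then have "of_real (1 / t) *\<^sub>C (T' z - T z) \<in> ?Z" using Z complex_vector.subspace_scale by blast
        also have "of_real (1 / t) *\<^sub>C (T' z - T z) = S z"
          unfolding scaleC_of_real T'_def using t by (simp add: blinfun.add_left blinfun.scaleR_left)
        finally show False using w(2) by blast
      qed
    qed
    with max[OF T'] small(1) show False unfolding T'_def by simp
  qed
  ultimately show ?thesis
    using that[of K "y ` {..<m}" R]
    by (auto simp: K_def R_def finite_dim_subspace_def image_subset_iff subset_iff)
qed

section \<open>The invariant half-space\<close>

theorem corollary3p4:
  fixes A :: "('a::chilbert_space \<Rightarrow>\<^sub>L 'a) set" and Y :: "'a set"
  assumes "operator_algebra A"
    and "closed A"
    and "half_space Y"
    and "\<And>T. T \<in> A \<Longrightarrow>
           \<exists>M. finite_dim_subspace M \<and> blinfun_apply T ` Y \<subseteq> Y + M"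
  shows "\<exists>L. half_space L \<and> (\<forall>T\<in>A. blinfun_apply T ` L \<subseteq> L)"
proof -
  have Y: "closed Y" "csubspace Y" "\<not> finite_dim_subspace Y" "\<not> finite_codim Y"
    using assms(3) unfolding half_space_def by auto
  obtain K M B where K: "K \<subseteq> Y" "finite B" "Y \<subseteq> cspan (K \<union> B)" "finite_dim_subspace M"
    "\<forall>T\<in>A. blinfun_apply T ` K \<subseteq> Y + M"
    by (rule uniform_defect_on_finite_codim[OF assms(1,2) Y(1,2) assms(4)])
  obtain F where F: "finite F" "M = cspan F"
    using K(4) unfolding finite_dim_subspace_def by blast
  \<comment> \<open>\<open>K\<close> keeps the span infinite-dimensional. One application of
    \<open>A\<close> suffices for invariance, as a product of two operators of \<open>A\<close> is
    again in \<open>A\<close>.\<close>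
  define G where "G = K \<union> (\<Union>T\<in>A. blinfun_apply T ` K)"
  define L where "L = closure (cspan G)"
  have subL: "csubspace L"
    unfolding L_def by (intro csubspace_closure complex_vector.subspace_span)
  have "G \<subseteq> L"
    unfolding L_def using complex_vector.span_superset closure_subset by blast
  have "L \<subseteq> Y + M"
    unfolding L_def F(2)
  proof (intro closure_minimal complex_vector.span_minimal)
    show "closed (Y + cspan F)" by (intro closed_set_plus_cspan Y F)
    show "csubspace (Y + cspan F)" by (intro csubspace_set_plus Y complex_vector.subspace_span)
    show "G \<subseteq> Y + cspan F"
      using K(1,5) subset_set_plus(1)[OF complex_vector.span_zero, of Y F]
      unfolding G_def F(2) by blast
  qed
  \<comment> \<open>A finite-dimensional \<open>M\<close> cannot turn the infinite codimension of
    \<open>Y\<close> into a finite one.\<close>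
  then have "\<not> finite_codim L"
    using finite_codim_mono finite_codim_set_plus K(4) Y(4) by blast
  moreover have "\<not> finite_dim_subspace L"
  proof
    assume "finite_dim_subspace L"
    then obtain E where E: "finite E" "L = cspan E"
      unfolding finite_dim_subspace_def by blast
    \<comment> \<open>A finite spanning set of \<open>L\<close>, joined with \<open>B\<close>, would
      span \<open>Y\<close>.\<close>
    have "K \<union> B \<subseteq> cspan (E \<union> B)"
      using \<open>G \<subseteq> L\<close> complex_vector.span_mono[of E "E \<union> B"] complex_vector.span_superset[of "E \<union> B"]
      unfolding E(2) G_def by blast
    then have "Y \<subseteq> cspan (E \<union> B)"
      using K(3) complex_vector.span_minimal complex_vector.subspace_span by blast
    with Y finite_dim_subspace_subset[of Y "E \<union> B"] E K(2) show False by blast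
  qed
  moreover have "blinfun_apply T ` L \<subseteq> L" if "T \<in> A" for T
    unfolding L_def
  proof (rule image_closure_subset)
    show "continuous_on (closure (cspan G)) (blinfun_apply T)"
      by (intro continuous_intros)
    have "blinfun_apply T ` G \<subseteq> G"
    proof -
      have "T (S x) \<in> G" if "S \<in> A" "x \<in> K" for S x
      proof -
        have "T o\<^sub>L S \<in> A" using assms(1) \<open>T \<in> A\<close> that unfolding operator_algebra_def by blast
        moreover have "T (S x) = (T o\<^sub>L S) x" by simp
        ultimately show ?thesis unfolding G_def using that(2) by blast
      qed
      with \<open>T \<in> A\<close> show ?thesis unfolding G_def by blast
    qed
    with \<open>G \<subseteq> L\<close> have "blinfun_apply T ` G \<subseteq> L" by blast
    moreover have "blinfun_apply T (c *\<^sub>C x) = c *\<^sub>C blinfun_apply T x" for c x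
      using assms(1) that unfolding operator_algebra_def bounded_operators_def by blast
    ultimately show "blinfun_apply T ` cspan G \<subseteq> closure (cspan G)"
      using subL unfolding L_def by (intro clinear_span_subset) (simp_all add: blinfun.add_right)
  qed simp
  ultimately show ?thesis
    using subL unfolding half_space_def L_def by (intro exI[of _ L]) (simp add: L_def)
qed

end
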